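(* Let $c>0$ be fixed. For positive integers $N$ let $\mu=\frac1{cN}$, $q=e^{-\mu}$, $\lambda=e^{1/c}-1$, $\beta_q=\sqrt{\frac{1+q}{1-q}}$, $\psi_n(x)=\sqrt{\beta_q}\,h_n(\beta_qx)\,e^{-\beta_q^2x^2/2}$ and $$K_\lambda(x,y)=\sum_{n=0}^\infty\frac{\lambda q^{n+1/2}}{1+\lambda q^{n+1/2}}\psi_n(x)\psi_n(y).$$ Set $$a_N(c)=\sqrt{\log N}-\frac{\log\big(4\pi\log N/(\lambda^2c^2)\big)}{4\sqrt{\log N}},\qquad b_N=\frac1{2\sqrt{\log N}}.$$ Then, pointwise for all real $\xi,\eta$, $$\lim_{N\to\infty}b_NK_\lambda\big(a_N(c)+b_N\xi,\ a_N(c)+b_N\eta\big)=K_{\mathrm{ext}}(\xi,\eta),$$ where $K_{\mathrm{ext}}(\xi,\eta)=e^{-\xi}$ if $\xi=\eta$ and $K_{\mathrm{ext}}(\xi,\eta)=0$ if $\xi\ne\eta$.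
   Context: $h_n$, $n\ge0$, are the normalized Hermite polynomials, $h_n(x)=\pi^{-1/4}(2^nn!)^{-1/2}H_n(x)$, orthonormal with respect to $e^{-x^2}dx$ on $\mathbb{R}$. The kernel $K_\lambda$ depends on $N$ through $q$. *)

theory Defs
  imports "HOL-Analysis.Analysis" "HOL-Computational_Algebra.Polynomial"
begin

text \<open>Physicists' Hermite polynomials \<open>H\<^sub>n\<close>, orthogonal with respect to \<open>exp (- x\<^sup>2)\<close>. The recursion is
  the one obtained by differentiating Rodrigues' formula, see \<open>hermite_rodrigues\<close>.\<close>

primrec hermite :: "nat \<Rightarrow> real poly" where
  "hermite 0 = 1"
| "hermite (Suc n) = [:0, 2:] * hermite n - pderiv (hermite n)"

lemma higher_deriv_gaussian:
  "(deriv ^^ n) (\<lambda>x::real. exp (- x\<^sup>2)) = (\<lambda>x. (-1) ^ n * poly (hermite n) x * exp (- x\<^sup>2))"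
proof (induction n)
  case (Suc n)
  have "((\<lambda>x. (-1) ^ n * poly (hermite n) x * exp (- x\<^sup>2)) has_field_derivative
      (-1) ^ Suc n * poly (hermite (Suc n)) x * exp (- x\<^sup>2)) (at x)" for x :: real
    by (auto intro!: derivative_eq_intros poly_DERIV simp: algebra_simps)
  then show ?case
    by (simp only: funpow.simps o_apply Suc) (blast intro: ext DERIV_imp_deriv)
qed simp

lemma hermite_rodrigues:
  "poly (hermite n) x = (-1) ^ n * exp (x\<^sup>2) * (deriv ^^ n) (\<lambda>x::real. exp (- x\<^sup>2)) x"
proof -
  have "exp (x\<^sup>2) * exp (- x\<^sup>2) = 1" and "(-1) ^ n * (-1) ^ n = (1::real)"
    by (simp_all add: exp_minus flip: power_mult_distrib)
  then show ?thesis
    by (simp only: higher_deriv_gaussian) (simp add: mult_ac)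
qed

definition hermite_normalized :: "nat \<Rightarrow> real \<Rightarrow> real" where
  "hermite_normalized n x = pi powr (- 1/4) * (2 ^ n * fact n) powr (- 1/2) * poly (hermite n) x"

definition beta :: "real \<Rightarrow> real" where
  "beta q = sqrt ((1 + q) / (1 - q))"

definition psi :: "real \<Rightarrow> nat \<Rightarrow> real \<Rightarrow> real" where
  "psi q n x = sqrt (beta q) * hermite_normalized n (beta q * x) * exp (- ((beta q)\<^sup>2 * x\<^sup>2) / 2)"

definition K :: "real \<Rightarrow> real \<Rightarrow> real \<Rightarrow> real \<Rightarrow> real" where
  "K q l x y = (\<Sum>n. l * q powr (real n + 1/2) / (1 + l * q powr (real n + 1/2)) * psi q n x * psi q n y)"

definition mu :: "real \<Rightarrow> nat \<Rightarrow> real" where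
  "mu c N = 1 / (c * real N)"

definition q_param :: "real \<Rightarrow> nat \<Rightarrow> real" where
  "q_param c N = exp (- mu c N)"

definition lam :: "real \<Rightarrow> real" where
  "lam c = exp (1 / c) - 1"

definition a_scale :: "real \<Rightarrow> nat \<Rightarrow> real" where
  "a_scale c N = sqrt (ln (real N))
     - ln (4 * pi * ln (real N) / ((lam c)\<^sup>2 * c\<^sup>2)) / (4 * sqrt (ln (real N)))"

definition b_scale :: "nat \<Rightarrow> real" where
  "b_scale N = 1 / (2 * sqrt (ln (real N)))"

definition K_ext :: "real \<Rightarrow> real \<Rightarrow> real" where
  "K_ext \<xi> \<eta> = (if \<xi> = \<eta> then exp (- \<xi>) else 0)"

end

theory Submission
  imports Defs "HOL-Real_Asymp.Real_Asymp"
begin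

text \<open>At the edge the weights \<open>t\<^sub>n = \<lambda> q\<^sup>n\<^sup>+\<^sup>1\<^sup>/\<^sup>2\<close> matter only to first order: since \<open>\<bar>t / (1 + t) - t\<bar> \<le> t\<^sup>2\<close>,
  the kernel differs from \<open>\<Sum> t\<^sub>n \<psi>\<^sub>n(x) \<psi>\<^sub>n(y)\<close> by at most \<open>\<Sum> t\<^sub>n\<^sup>2 (\<psi>\<^sub>n(x)\<^sup>2 + \<psi>\<^sub>n(y)\<^sup>2) / 2\<close>. Mehler's formula
  evaluates both sums. Because \<open>\<beta>\<^sup>2 (1 - q) / (1 + q) = 1\<close>, the first is a multiple of
  \<open>exp (- (x + y)\<^sup>2 / 4 - \<beta>\<^sup>4 (x - y)\<^sup>2 / 4)\<close>: the scaling makes it converge to \<open>exp (- \<xi>)\<close> on the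
  diagonal, and the factor \<open>\<beta>\<^sup>4 b\<^sub>N\<^sup>2 \<rightarrow> \<infinity>\<close> kills it off the diagonal. The second carries the weight
  \<open>q\<^sup>2\<^sup>n\<close>, so it decays at least like \<open>exp (- 3 x\<^sup>2 / 2)\<close> and is negligible.

  Mehler's formula itself holds because both sides, as functions of \<open>w\<close> on \<open>(-1, 1)\<close>, solve the same
  linear first-order differential equation.\<close>

section \<open>Recurrences for the Hermite polynomials\<close>

text \<open>Differentiating the recursion leaves \<open>2 * x * H' - H''\<close> for
  \<open>H = hermite (Suc n)\<close>; the induction hypothesis turns this into a multiple of the
  recursion one index lower, which reassembles \<open>H\<close> itself.\<close>

lemma pderiv_hermite_Suc: "pderiv (hermite (Suc n)) = smult (2 * real (Suc n)) (hermite n)"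
proof (induction n)
  case 0
  show ?case by (simp add: pderiv_pCons pderiv_mult)
next
  case (Suc n)
  have "pderiv (hermite (Suc (Suc n)))
      = pderiv ([:0, 2:] * hermite (Suc n)) - pderiv (pderiv (hermite (Suc n)))"
    by (simp only: hermite.simps(2)[of "Suc n"] pderiv_diff)
  also have "\<dots> = smult 2 (hermite (Suc n))
      + smult (2 * real (Suc n)) ([:0, 2:] * hermite n - pderiv (hermite n))"
    by (simp add: Suc pderiv_mult pderiv_pCons pderiv_smult smult_diff_right del: hermite.simps)
  also have "\<dots> = smult (2 * real (Suc (Suc n))) (hermite (Suc n))"
    unfolding hermite.simps(2)[of n, symmetric] smult_add_left[symmetric] by simp
  finally show ?case .
qed

lemma poly_hermite_Suc_Suc:
  "poly (hermite (Suc (Suc n))) x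
     = 2 * x * poly (hermite (Suc n)) x - 2 * real (Suc n) * poly (hermite n) x"
  by (subst hermite.simps(2)) (simp add: pderiv_hermite_Suc del: hermite.simps)

section \<open>The Mehler power series and its differential equation\<close>

text \<open>This is \<open>sqrt pi\<close> times the product of the normalized Hermite values at
  \<open>x\<close> and \<open>y\<close>.\<close>

definition mehler_coeff :: "real \<Rightarrow> real \<Rightarrow> nat \<Rightarrow> real" where
  "mehler_coeff x y n = poly (hermite n) x * poly (hermite n) y / (2 ^ n * fact n)"

lemma mehler_coeff_0: "mehler_coeff x y 0 = 1"
  by (simp add: mehler_coeff_def)

lemma poly_hermite_1: "poly (hermite (Suc 0)) x = 2 * x"
  by simp

lemma mehler_coeff_1: "mehler_coeff x y (Suc 0) = 2 * x * y"
  by (simp add: mehler_coeff_def)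

lemma mehler_coeff_2: "mehler_coeff x y (Suc (Suc 0)) = (2 * x\<^sup>2 - 1) * (2 * y\<^sup>2 - 1) / 2"
  by (simp add: mehler_coeff_def poly_hermite_Suc_Suc poly_hermite_1 power2_eq_square field_simps
      del: hermite.simps(2))

lemma mehler_coeff_3:
  "mehler_coeff x y (Suc (Suc (Suc 0))) = (2 * x ^ 3 - 3 * x) * (2 * y ^ 3 - 3 * y) / 3"
  by (simp add: mehler_coeff_def poly_hermite_Suc_Suc poly_hermite_1 power3_eq_cube field_simps
      del: hermite.simps(2))

text \<open>This is the coefficient of \<open>w ^ (m + 3)\<close> in the differential equation of
  \<open>fps_mehler_ode\<close>.\<close>

lemma mehler_coeff_recurrence:
  fixes x y :: real
  defines "c \<equiv> mehler_coeff x y"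
  shows "real (m + 4) * c (m + 4) - 2 * real (m + 2) * c (m + 2) + real m * c m
     = c (m + 2) - c m + 2 * x * y * (c (m + 3) + c (m + 1)) - 2 * (x\<^sup>2 + y\<^sup>2) * c (m + 2)"
proof -
  \<comment> \<open>By the three-term recurrence all five coefficients are rational expressions in
    the Hermite values of degree \<open>m\<close> and \<open>m + 1\<close>, so only a polynomial
    identity has to be verified.\<close>
  define a b A B where "a = poly (hermite m) x" and "b = poly (hermite (Suc m)) x"
    and "A = poly (hermite m) y" and "B = poly (hermite (Suc m)) y"
  define M where "M = real m"
  define d where "d = (2 ^ m * fact m :: real)"
  have nz: "d \<noteq> 0" "M + 1 \<noteq> 0" "M + 2 \<noteq> 0" "M + 3 \<noteq> 0" "M + 4 \<noteq> 0"
    by (auto simp: d_def M_def)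
  define a2 where "a2 = 2*x*b - 2*(M+1)*a"
  define a3 where "a3 = 2*x*a2 - 2*(M+2)*b"
  define a4 where "a4 = 2*x*a3 - 2*(M+3)*a2"
  define A2 where "A2 = 2*y*B - 2*(M+1)*A"
  define A3 where "A3 = 2*y*A2 - 2*(M+2)*B"
  define A4 where "A4 = 2*y*A3 - 2*(M+3)*A2"
  have c0: "c m = a * A / d"
    by (simp add: c_def mehler_coeff_def a_def A_def d_def)
  have c1: "c (m + 1) = b * B / (2 * (M+1) * d)"
    by (simp add: c_def mehler_coeff_def b_def B_def d_def M_def algebra_simps del: hermite.simps)
  have c2: "c (m + 2) = a2 * A2 / (4 * (M+1) * (M+2) * d)"
    by (simp add: c_def mehler_coeff_def a_def b_def A_def B_def d_def M_def a2_def A2_def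
        poly_hermite_Suc_Suc algebra_simps del: hermite.simps)
  have c3: "c (m + 3) = a3 * A3 / (8 * (M+1) * (M+2) * (M+3) * d)"
    by (simp add: c_def mehler_coeff_def a_def b_def A_def B_def d_def M_def a2_def A2_def a3_def A3_def
        poly_hermite_Suc_Suc eval_nat_numeral algebra_simps del: hermite.simps)
  have c4: "c (m + 4) = a4 * A4 / (16 * (M+1) * (M+2) * (M+3) * (M+4) * d)"
    by (simp add: c_def mehler_coeff_def a_def b_def A_def B_def d_def M_def a2_def A2_def a3_def A3_def
        a4_def A4_def poly_hermite_Suc_Suc eval_nat_numeral algebra_simps del: hermite.simps)
  have "real (m + 4) = M + 4" "real (m + 2) = M + 2" "real m = M"
    by (simp_all add: M_def)
  note R = this
  \<comment> \<open>The claim multiplied by \<open>16 * (M+1) * (M+2) * (M+3) * d\<close>.\<close>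
  have "a4 * A4 - 8 * (M+2) * (M+3) * a2 * A2 + 16 * M * (M+1) * (M+2) * (M+3) * a * A
      = 4 * (M+3) * a2 * A2 - 16 * (M+1) * (M+2) * (M+3) * a * A
        + 2 * x * y * (2 * a3 * A3 + 8 * (M+2) * (M+3) * b * B)
        - 8 * (M+3) * (x\<^sup>2 + y\<^sup>2) * a2 * A2"
    unfolding a4_def A4_def a3_def A3_def a2_def A2_def by algebra
  then show ?thesis
    unfolding R c0 c1 c2 c3 c4 using nz
    by (simp add: divide_simps) algebra
qed

text \<open>Expanded form of \<open>(1 - w^2)^2 F' = (w (1 - w^2) + 2xy (1 + w^2) - 2 (x^2 + y^2) w)
  F\<close>, the equation solved by Mehler's closed form. Every summand is a shifted series, so
  coefficients can be compared directly.\<close>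

lemma fps_mehler_ode:
  fixes x y :: real
  defines "F \<equiv> Abs_fps (mehler_coeff x y)"
  shows "fps_deriv F = fps_const 2 * (fps_X ^ 2 * fps_deriv F) - fps_X ^ 4 * fps_deriv F
     + fps_X * F - fps_X ^ 3 * F + fps_const (2 * x * y) * (F + fps_X ^ 2 * F)
     - fps_const (2 * (x\<^sup>2 + y\<^sup>2)) * (fps_X * F)" (is "_ = ?R")
proof (rule fps_ext)
  fix n :: nat
  \<comment> \<open>Below index 3 some shifts reach before the start of the series. These cases use
    the explicit coefficients up to index 3, since \<open>fps_deriv\<close> raises the index by
    one.\<close>
  consider "n = 0" | "n = 1" | "n = 2" | m where "n = m + 3"
  proof (cases "n < 3")
    case False
    then show ?thesis
      using that(4)[of "n - 3"] by simp
  qed (use that in linarith)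
  then show "fps_nth (fps_deriv F) n = fps_nth ?R n"
  proof cases
    case (4 m)
    show ?thesis
      using mehler_coeff_recurrence[of m x y]
      \<comment> \<open>For \<open>m = 0\<close> the shift by 4 yields 0, in agreement with the term
        \<open>real m * c m\<close>.\<close>
      by (cases "m = 0") (simp_all add: 4 F_def fps_X_power_mult_nth eval_nat_numeral algebra_simps)
  qed (simp_all add: F_def fps_X_power_mult_nth mehler_coeff_0 mehler_coeff_1 mehler_coeff_2
        mehler_coeff_3 eval_nat_numeral field_simps)
qed

section \<open>Growth of Hermite values and summation of the Mehler series\<close>

text \<open>The normalized values \<open>g\<^sub>n\<close> satisfy \<open>g\<^sub>n\<^sub>+\<^sub>2 \<le> o(1) g\<^sub>n\<^sub>+\<^sub>1 + g\<^sub>n\<close>, and \<open>\<delta>\<close> below is chosen such that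
  \<open>g\<^sub>n\<^sub>+\<^sub>2 \<le> \<delta> g\<^sub>n\<^sub>+\<^sub>1 + g\<^sub>n\<close> propagates a bound \<open>C \<rho>\<^sup>n\<close>.\<close>

lemma hermite_subexponential:
  assumes "\<rho> > 1"
  obtains C where "\<And>n. \<bar>poly (hermite n) x\<bar> / sqrt (2 ^ n * fact n) \<le> C * \<rho> ^ n"
proof -
  define g where "g n = \<bar>poly (hermite n) x\<bar> / sqrt (2 ^ n * fact n)" for n
  define \<delta> where "\<delta> = \<rho> - 1 / \<rho>"
  have \<delta>: "\<delta> > 0" "\<delta> * \<rho> + 1 = \<rho>\<^sup>2"
    using assms by (auto simp: \<delta>_def field_simps power2_eq_square intro: less_1_mult)
  have rec: "g (Suc (Suc n)) \<le> \<bar>x\<bar> * sqrt 2 / sqrt (real (n + 2)) * g (Suc n) + g n" for n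
  proof -
    define s where "s = sqrt (2 ^ n * fact n)"
    have s: "s > 0" by (simp add: s_def)
    have s1: "sqrt (2 ^ Suc n * fact (Suc n)) = sqrt 2 * sqrt (real (n+1)) * s"
      by (simp add: s_def real_sqrt_mult mult_ac)
    have s2: "sqrt (2 ^ Suc (Suc n) * fact (Suc (Suc n)))
        = sqrt 2 * sqrt (real (n+2)) * (sqrt 2 * sqrt (real (n+1)) * s)"
      by (simp add: s_def real_sqrt_mult mult_ac)
    have "\<bar>poly (hermite (Suc (Suc n))) x\<bar>
       \<le> 2 * \<bar>x\<bar> * \<bar>poly (hermite (Suc n)) x\<bar> + 2 * real (n+1) * \<bar>poly (hermite n) x\<bar>"
      unfolding poly_hermite_Suc_Suc by (rule order_trans[OF abs_triangle_ineq4]) (simp add: abs_mult)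
    then have "g (Suc (Suc n)) \<le> (2 * \<bar>x\<bar> * \<bar>poly (hermite (Suc n)) x\<bar>
        + 2 * real (n+1) * \<bar>poly (hermite n) x\<bar>) / (2 * sqrt (real (n+2)) * sqrt (real (n+1)) * s)"
      unfolding g_def s2 using s by (intro divide_mono) (auto simp: mult_ac)
    also have "\<dots> = \<bar>x\<bar> * sqrt 2 / sqrt (real (n + 2)) * g (Suc n)
        + sqrt (real (n+1)) / sqrt (real (n+2)) * g n"
    proof -
      define u v where "u = sqrt (real (n+1))" and "v = sqrt (real (n+2))"
      have uv: "u > 0" "v > 0" "real (n+1) = u * u" by (auto simp: u_def v_def)
      have g0: "g n = \<bar>poly (hermite n) x\<bar> / s" by (simp add: g_def s_def)
      have g1: "g (Suc n) = \<bar>poly (hermite (Suc n)) x\<bar> / (sqrt 2 * u * s)"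
        unfolding g_def s1 u_def ..
      show ?thesis
        unfolding g0 g1 u_def[symmetric] v_def[symmetric] uv(3) using uv(1,2) s
        by (simp add: field_simps del: hermite.simps)
    qed
    also have "\<dots> \<le> \<bar>x\<bar> * sqrt 2 / sqrt (real (n + 2)) * g (Suc n) + 1 * g n"
      by (intro add_left_mono mult_right_mono) (auto simp: g_def)
    finally show ?thesis by simp
  qed
  have "(\<lambda>n. \<bar>x\<bar> * sqrt 2 / sqrt (real (n + 2))) \<longlonglongrightarrow> 0"
    by real_asymp
  from order_tendstoD(2)[OF this \<delta>(1)]
  obtain m where m: "\<And>n. n \<ge> m \<Longrightarrow> \<bar>x\<bar> * sqrt 2 / sqrt (real (n + 2)) < \<delta>"
    by (auto simp: eventually_sequentially)
  \<comment> \<open>The recursion is used from \<open>m\<close> on, so its two starting values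
    \<open>g m\<close> and \<open>g (Suc m)\<close> must be covered too.\<close>
  define C where "C = (\<Sum>k\<le>Suc m. g k)"
  have g_nonneg: "g n \<ge> 0" for n
    by (simp add: g_def)
  then have C0: "C \<ge> 0"
    by (simp add: C_def sum_nonneg)
  have low: "g n \<le> C * \<rho> ^ n" if "n \<le> Suc m" for n
  proof -
    have "g n \<le> C"
      unfolding C_def using that g_nonneg by (intro member_le_sum) auto
    also have "\<dots> \<le> C * \<rho> ^ n"
      using C0 assms by (simp add: mult_le_cancel_left1)
    finally show ?thesis .
  qed
  have "g n \<le> C * \<rho> ^ n" for n
  proof (induction n rule: less_induct)
    case (less n)
    show ?case
    proof (cases "n \<le> Suc m")
      case False
      then obtain k where k: "n = Suc (Suc k)" "k \<ge> m"
        by (metis Suc_le_D Suc_le_mono not_less_eq_eq)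
      have "g n \<le> \<bar>x\<bar> * sqrt 2 / sqrt (real (k + 2)) * g (Suc k) + g k"
        unfolding k by (rule rec)
      also have "\<dots> \<le> \<delta> * (C * \<rho> ^ Suc k) + C * \<rho> ^ k"
        using m[OF k(2)] less.IH[of k] less.IH[of "Suc k"] g_nonneg \<delta>(1)
        by (intro add_mono mult_mono) (auto simp: k(1))
      also have "\<dots> = C * \<rho> ^ k * (\<delta> * \<rho> + 1)"
        by (simp add: algebra_simps)
      also have "\<dots> = C * \<rho> ^ n"
        by (simp add: \<delta>(2) k(1) power2_eq_square)
      finally show ?thesis .
    qed (rule low)
  qed
  with that show thesis
    unfolding g_def by blast
qed

text \<open>Each of the two Hermite factors costs at most a multiple of \<open>\<rho> ^ n\<close>.
  With \<open>\<rho> ^ 4 = 1 / w\<close> the terms are dominated by a geometric series of ratio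
  \<open>1 / \<rho>\<^sup>2\<close>.\<close>

lemma summable_mehler_abs:
  assumes "0 \<le> w" "w < 1"
  shows "summable (\<lambda>n. \<bar>mehler_coeff x y n\<bar> * w ^ n)"
proof (cases "w = 0")
  case False
  define \<rho> where "\<rho> = root 4 (1 / w)"
  have \<rho>: "\<rho> > 1" "\<rho> ^ 4 = 1 / w"
    using assms False by (auto simp: \<rho>_def)
  obtain C where C: "\<And>n. \<bar>poly (hermite n) x\<bar> / sqrt (2 ^ n * fact n) \<le> C * \<rho> ^ n"
    using hermite_subexponential[OF \<rho>(1)] by blast
  obtain D where D: "\<And>n. \<bar>poly (hermite n) y\<bar> / sqrt (2 ^ n * fact n) \<le> D * \<rho> ^ n"
    using hermite_subexponential[OF \<rho>(1)] by blast
  have w: "w = 1 / \<rho> ^ 4"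
    using \<rho> False assms by simp
  have "norm (\<bar>mehler_coeff x y n\<bar> * w ^ n) \<le> C * D * (1 / \<rho>\<^sup>2) ^ n" for n
  proof -
    have "\<bar>mehler_coeff x y n\<bar> = (\<bar>poly (hermite n) x\<bar> / sqrt (2 ^ n * fact n))
        * (\<bar>poly (hermite n) y\<bar> / sqrt (2 ^ n * fact n))"
      by (simp add: mehler_coeff_def abs_mult)
    also have "\<dots> \<le> (C * \<rho> ^ n) * (D * \<rho> ^ n)"
      using order_trans[OF _ C[of n]] by (intro mult_mono C D) auto
    finally have "\<bar>mehler_coeff x y n\<bar> * w ^ n \<le> (C * \<rho> ^ n) * (D * \<rho> ^ n) * w ^ n"
      using assms by (intro mult_right_mono) auto
    also have "\<dots> = C * D * (\<rho> * \<rho> * w) ^ n"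
      by (simp add: power_mult_distrib)
    also have "\<rho> * \<rho> * w = 1 / \<rho>\<^sup>2"
      unfolding w using \<rho>(1) by (simp add: field_simps eval_nat_numeral)
    finally show ?thesis
      using assms by simp
  qed
  moreover have "summable (\<lambda>n. C * D * (1 / \<rho>\<^sup>2) ^ n)"
    using \<rho>(1) by (intro summable_mult summable_geometric) (simp add: one_less_power)
  ultimately show ?thesis
    by (rule summable_comparison_test'[where N = 0, rotated])
qed (simp add: summable_0_powser)

theorem mehler_formula:
  assumes "0 \<le> w" "w < 1"
  shows "(\<lambda>n. mehler_coeff x y n * w ^ n) sums
    (exp ((2 * x * y * w - (x\<^sup>2 + y\<^sup>2) * w\<^sup>2) / (1 - w\<^sup>2)) / sqrt (1 - w\<^sup>2))"
proof -
  define F where "F = Abs_fps (mehler_coeff x y)"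
  define F' where "F' = eval_fps (fps_deriv F)"
  define h where "h v = (2 * x * y * v - (x\<^sup>2 + y\<^sup>2) * v\<^sup>2) / (1 - v\<^sup>2)" for v
  \<comment> \<open>The series divided by the claimed sum; the differential equation makes this
    quotient constant.\<close>
  define Q where "Q v = eval_fps F v * (sqrt (1 - v\<^sup>2) * exp (- h v))" for v
  have radius: "fps_conv_radius F \<ge> 1"
    unfolding fps_conv_radius_def F_def
  proof (rule conv_radius_geI_ex')
    fix r :: real assume r: "0 < r" "ereal r < 1"
    then have "summable (\<lambda>n. norm (mehler_coeff x y n * r ^ n))"
      using summable_mehler_abs[of r x y] by (simp add: abs_mult)
    then show "summable (\<lambda>n. fps_nth (Abs_fps (mehler_coeff x y)) n * of_real r ^ n)"
      by (simp add: summable_norm_cancel)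
  qed
  then have radius': "fps_conv_radius (fps_deriv F) \<ge> 1"
    using fps_conv_radius_deriv[of F] by (rule order_trans)
  have conv: "ereal (norm v) < fps_conv_radius F" "ereal (norm v) < fps_conv_radius (fps_deriv F)"
    if "\<bar>v\<bar> < 1" for v :: real
    using that radius radius' by (auto intro: less_le_trans[of _ 1] simp: one_ereal_def)
  have ode: "F' v = 2 * (v\<^sup>2 * F' v) - v ^ 4 * F' v + v * eval_fps F v - v ^ 3 * eval_fps F v
      + 2 * x * y * (eval_fps F v + v\<^sup>2 * eval_fps F v) - 2 * (x\<^sup>2 + y\<^sup>2) * (v * eval_fps F v)"
    if "\<bar>v\<bar> < 1" for v
  proof -
    have s0: "(\<lambda>n. fps_nth F n * v ^ n) sums eval_fps F v"
      and s1: "(\<lambda>n. fps_nth (fps_deriv F) n * v ^ n) sums F' v"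
      unfolding F'_def using conv[OF that] by (blast intro: sums_eval_fps)+
    have shift: "(\<lambda>n. fps_nth (fps_X ^ k * G) n * v ^ n) sums (v ^ k * g)"
      if "(\<lambda>n. fps_nth G n * v ^ n) sums g" for k g and G :: "real fps"
    proof -
      have "fps_nth (fps_X ^ k * G) (n + k) * v ^ (n + k) = v ^ k * (fps_nth G n * v ^ n)" for n
        unfolding fps_X_power_mult_nth by (simp add: power_add)
      then have "(\<lambda>n. fps_nth (fps_X ^ k * G) (n + k) * v ^ (n + k)) sums (v ^ k * g)"
        using sums_mult[OF that, of "v ^ k"] by simp
      then show ?thesis
        by (subst (asm) sums_iff_shift) (simp add: fps_X_power_mult_nth)
    qed
    \<comment> \<open>The nesting follows the order of the summands in
      \<open>fps_mehler_ode\<close>.\<close>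
    note S = sums_diff[OF sums_add[OF sums_diff[OF sums_add[OF sums_diff[OF
       sums_mult[OF shift[OF s1, of 2], of 2] shift[OF s1, of 4]] shift[OF s0, of 1]] shift[OF s0, of 3]]
       sums_mult[OF sums_add[OF s0 shift[OF s0, of 2]], of "2 * x * y"]]
       sums_mult[OF shift[OF s0, of 1], of "2 * (x\<^sup>2 + y\<^sup>2)"]]
    have "(\<lambda>n. fps_nth (fps_deriv F) n * v ^ n) sums
      (2 * (v\<^sup>2 * F' v) - v ^ 4 * F' v + v ^ 1 * eval_fps F v - v ^ 3 * eval_fps F v
      + 2 * x * y * (eval_fps F v + v\<^sup>2 * eval_fps F v) - 2 * (x\<^sup>2 + y\<^sup>2) * (v ^ 1 * eval_fps F v))"
      by (rule sums_cong[THEN iffD2, OF _ S],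
          subst fps_mehler_ode[of x y, folded F_def])
        (simp only: fps_sub_nth fps_add_nth fps_mult_left_const_nth power_one_right,
         simp add: algebra_simps del: fps_deriv_nth)
    from sums_unique2[OF s1 this] show ?thesis by simp
  qed
  have "(Q has_real_derivative 0) (at v)" if "v \<in> {-1<..<1}" for v
  proof -
    from that have v: "\<bar>v\<bar> < 1" by auto
    then have pos: "1 - v\<^sup>2 > 0" by (simp add: abs_square_less_1)
    define r where "r = sqrt (1 - v\<^sup>2)"
    have r: "r > 0" "r\<^sup>2 = 1 - v\<^sup>2" using pos by (auto simp: r_def)
    have dF: "(eval_fps F has_real_derivative F' v) (at v)"
      unfolding F'_def by (rule has_field_derivative_eval_fps[OF conv(1)[OF v]])
    define h' where "h' = ((2*x*y - (x\<^sup>2 + y\<^sup>2) * (2 * v)) * (1 - v\<^sup>2)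
        + (2 * x * y * v - (x\<^sup>2 + y\<^sup>2) * v\<^sup>2) * (2 * v)) / (1 - v\<^sup>2)\<^sup>2"
    have dh: "(h has_real_derivative h') (at v)"
      unfolding h_def[abs_def] h'_def using pos
      by (auto intro!: derivative_eq_intros simp: power2_eq_square)
    have ds: "((\<lambda>v. sqrt (1 - v\<^sup>2)) has_real_derivative - v / r) (at v)"
      unfolding r_def using pos by (auto intro!: derivative_eq_intros simp: field_simps)
    have zero: "F' v * r + eval_fps F v * (- v / r) - eval_fps F v * r * h' = 0"
    proof -
      \<comment> \<open>The bracket is \<open>(1 - v^2)^2\<close> times
        \<open>v / (1 - v^2) + h'\<close>, the logarithmic derivative of the claimed sum.\<close>
      have "(1 - v\<^sup>2)\<^sup>2 * F' v = (v * (1 - v\<^sup>2) + 2 * x * y * (1 + v\<^sup>2) - 2 * (x\<^sup>2 + y\<^sup>2) * v) * eval_fps F v"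
        using ode[OF v] by algebra
      also have "\<dots> = (v * (1 - v\<^sup>2) + h' * (1 - v\<^sup>2)\<^sup>2) * eval_fps F v"
      proof -
        have "h' * (1 - v\<^sup>2)\<^sup>2 = (2*x*y - (x\<^sup>2 + y\<^sup>2) * (2 * v)) * (1 - v\<^sup>2)
            + (2 * x * y * v - (x\<^sup>2 + y\<^sup>2) * v\<^sup>2) * (2 * v)"
          unfolding h'_def using pos by simp
        then show ?thesis by algebra
      qed
      finally have "r\<^sup>2 * (r\<^sup>2 * F' v) = r\<^sup>2 * ((v + h' * r\<^sup>2) * eval_fps F v)"
        unfolding r(2)[symmetric] by (simp add: power2_eq_square algebra_simps)
      then have "r\<^sup>2 * F' v = (v + h' * r\<^sup>2) * eval_fps F v"
        using r(1) by (subst (asm) mult_left_cancel) auto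
      then show ?thesis
        using r(1) by (simp add: field_simps power2_eq_square)
    qed
    have "(Q has_real_derivative (F' v * r + eval_fps F v * (- v / r) - eval_fps F v * r * h')
        * exp (- h v)) (at v)"
      unfolding Q_def[abs_def]
      by (rule derivative_eq_intros dF ds dh refl)+ (simp add: r_def[symmetric] algebra_simps)
    then show ?thesis
      by (simp only: zero mult_zero_left)
  qed
  then have "Q w = Q 0"
    using assms by (intro DERIV_isconst3[of "-1" 1]) auto
  also have "\<dots> = 1"
    by (simp add: Q_def h_def eval_fps_at_0 F_def mehler_coeff_0)
  finally have "eval_fps F w = exp (h w) / sqrt (1 - w\<^sup>2)"
    using assms abs_square_less_1[of w] by (auto simp: Q_def exp_minus field_simps)
  moreover have "(\<lambda>n. mehler_coeff x y n * w ^ n) sums eval_fps F w"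
    using sums_eval_fps[OF conv(1), of w] assms by (simp add: F_def)
  ultimately show ?thesis
    by (simp add: h_def)
qed

section \<open>Mehler's formula for the rescaled functions, and linearization of the weights\<close>

text \<open>Writing the exponent in \<open>x + y\<close> and \<open>x - y\<close> separates the
  position of the two points from their distance, which have different limits under the edge
  scaling.\<close>

definition mehler_kernel :: "real \<Rightarrow> real \<Rightarrow> real \<Rightarrow> real \<Rightarrow> real" where
  "mehler_kernel q w x y = beta q / sqrt (pi * (1 - w\<^sup>2))
     * exp (- ((1 - w) / (1 + w) * ((beta q)\<^sup>2 * (x + y)\<^sup>2 / 4))
            - (1 + w) / (1 - w) * ((beta q)\<^sup>2 * (x - y)\<^sup>2 / 4))"

lemma psi_mult_psi:
  assumes "0 < q" "q < 1"
  shows "psi q n x * psi q n y = beta q / sqrt pi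
    * exp (- ((beta q)\<^sup>2 * (x\<^sup>2 + y\<^sup>2) / 2)) * mehler_coeff (beta q * x) (beta q * y) n"
proof -
  have "beta q \<ge> 0"
    using assms by (simp add: beta_def)
  then have b: "sqrt (beta q) * sqrt (beta q) = beta q" by simp
  have p: "pi powr (- 1/4) * pi powr (- 1/4) = 1 / sqrt pi"
    by (simp add: powr_add[symmetric] powr_minus powr_half_sqrt field_simps)
  have f: "(2 ^ n * fact n) powr (- 1/2) * (2 ^ n * fact n) powr (- 1/2) = 1 / (2 ^ n * fact n :: real)"
    by (simp add: powr_add[symmetric] powr_minus field_simps)
  have e: "exp (- ((beta q)\<^sup>2 * x\<^sup>2) / 2) * exp (- ((beta q)\<^sup>2 * y\<^sup>2) / 2)
      = exp (- ((beta q)\<^sup>2 * (x\<^sup>2 + y\<^sup>2) / 2))"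
    by (simp add: exp_add[symmetric] field_simps)
  have "psi q n x * psi q n y = (sqrt (beta q) * sqrt (beta q)) * (pi powr (- 1/4) * pi powr (- 1/4))
     * (exp (- ((beta q)\<^sup>2 * x\<^sup>2) / 2) * exp (- ((beta q)\<^sup>2 * y\<^sup>2) / 2))
     * (((2 ^ n * fact n) powr (- 1/2) * (2 ^ n * fact n) powr (- 1/2))
     * (poly (hermite n) (beta q * x) * poly (hermite n) (beta q * y)))"
    unfolding psi_def hermite_normalized_def by (simp only: mult_ac)
  then show ?thesis
    unfolding b p f e by (simp add: mehler_coeff_def)
qed

lemma psi_sums:
  assumes q: "0 < q" "q < 1" and w: "0 \<le> w" "w < 1"
  shows "(\<lambda>n. w ^ n * (psi q n x * psi q n y)) sums mehler_kernel q w x y"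
proof -
  define X Y where "X = beta q * x" and "Y = beta q * y"
  have w2: "1 - w\<^sup>2 = (1 - w) * (1 + w)" "1 - w > 0" "1 + w > 0"
    using w by (auto simp: power2_eq_square algebra_simps)
  \<comment> \<open>The Gaussian weight of the \<open>psi\<close> and the exponent of Mehler's
    formula are combined and diagonalized.\<close>
  have ex: "- (X\<^sup>2 + Y\<^sup>2) / 2 + (2 * X * Y * w - (X\<^sup>2 + Y\<^sup>2) * w\<^sup>2) / (1 - w\<^sup>2)
    = - ((1 - w) / (1 + w) * ((X + Y)\<^sup>2 / 4)) - (1 + w) / (1 - w) * ((X - Y)\<^sup>2 / 4)"
    unfolding w2(1) using w2(2,3) by (simp add: divide_simps) algebra
  have "beta q / sqrt pi * exp (- (X\<^sup>2 + Y\<^sup>2) / 2) *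
      (exp ((2 * X * Y * w - (X\<^sup>2 + Y\<^sup>2) * w\<^sup>2) / (1 - w\<^sup>2)) / sqrt (1 - w\<^sup>2))
    = beta q / sqrt (pi * (1 - w\<^sup>2)) * exp (- (X\<^sup>2 + Y\<^sup>2) / 2 + (2 * X * Y * w - (X\<^sup>2 + Y\<^sup>2) * w\<^sup>2) / (1 - w\<^sup>2))"
    by (simp add: exp_add real_sqrt_mult)
  also have "\<dots> = mehler_kernel q w x y"
    unfolding ex unfolding mehler_kernel_def X_def Y_def
    by (simp add: power_mult_distrib distrib_left[symmetric] right_diff_distrib[symmetric])
  finally have "(\<lambda>n. beta q / sqrt pi * exp (- (X\<^sup>2 + Y\<^sup>2) / 2) * (mehler_coeff X Y n * w ^ n))
      sums mehler_kernel q w x y"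
    using sums_mult[OF mehler_formula[OF w, of X Y], of "beta q / sqrt pi * exp (- (X\<^sup>2 + Y\<^sup>2) / 2)"]
    by simp
  moreover have "beta q / sqrt pi * exp (- (X\<^sup>2 + Y\<^sup>2) / 2) * (mehler_coeff X Y n * w ^ n)
      = w ^ n * (psi q n x * psi q n y)" for n
    unfolding psi_mult_psi[OF q] X_def Y_def by (simp only: power_mult_distrib distrib_left minus_divide_left mult_ac)
  ultimately show ?thesis
    by simp
qed

text \<open>The squared weights are geometric with ratio \<open>q\<^sup>2\<close>, and
  \<open>2 * \<bar>a * b\<bar> \<le> a^2 + b^2\<close> separates the points, so the error is
  majorized by diagonal Mehler sums at \<open>w = q\<^sup>2\<close>.\<close>

lemma K_mehler_kernel_bound:
  assumes q: "0 < q" "q < 1" and l: "l > 0"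
  shows "\<bar>K q l x y - l * sqrt q * mehler_kernel q q x y\<bar>
    \<le> l\<^sup>2 * q * ((mehler_kernel q (q\<^sup>2) x x + mehler_kernel q (q\<^sup>2) y y) / 2)"
proof -
  define t where "t n = l * q powr (real n + 1/2)" for n :: nat
  define p where "p n = psi q n x * psi q n y" for n
  define E where "E n = t n / (1 + t n) * p n - t n * p n" for n
  define B where "B n = l\<^sup>2 * q * (((q\<^sup>2) ^ n * (psi q n x * psi q n x) + (q\<^sup>2) ^ n * (psi q n y * psi q n y)) / 2)"
    for n
  have t: "t n = l * sqrt q * q ^ n" for n
    using q by (simp add: t_def powr_add powr_realpow powr_half_sqrt)
  have tpos: "t n > 0" for n
    using q l by (simp add: t)
  have t2: "(t n)\<^sup>2 = l\<^sup>2 * q * (q\<^sup>2) ^ n" for n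
    using q by (simp add: t power_mult_distrib power_mult[symmetric] mult.commute)
  have q2: "0 \<le> q\<^sup>2" "q\<^sup>2 < 1"
    using q by (auto simp: power_less_one_iff)
  have B: "B sums (l\<^sup>2 * q * ((mehler_kernel q (q\<^sup>2) x x + mehler_kernel q (q\<^sup>2) y y) / 2))"
    unfolding B_def by (intro sums_mult sums_divide sums_add psi_sums q q2)
  have tp: "(\<lambda>n. t n * p n) sums (l * sqrt q * mehler_kernel q q x y)"
    using sums_mult[OF psi_sums[OF q less_imp_le[OF q(1)] q(2), of x y], of "l * sqrt q"]
    by (simp add: t p_def mult_ac)
  have EB: "norm (E n) \<le> B n" for n
  proof -
    have "E n = - ((t n)\<^sup>2 / (1 + t n) * p n)"
      using tpos[of n] by (simp add: E_def field_simps power2_eq_square)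
    then have "\<bar>E n\<bar> = (t n)\<^sup>2 / (1 + t n) * \<bar>p n\<bar>"
      using tpos[of n] by (simp add: abs_mult)
    also have "\<dots> \<le> (t n)\<^sup>2 * ((psi q n x * psi q n x + psi q n y * psi q n y) / 2)"
    proof (rule mult_mono)
      show "(t n)\<^sup>2 / (1 + t n) \<le> (t n)\<^sup>2"
        using tpos[of n] by (simp add: divide_le_eq mult_le_cancel_left1)
      have "2 * \<bar>p n\<bar> \<le> (psi q n x)\<^sup>2 + (psi q n y)\<^sup>2"
        using sum_squares_bound[of "\<bar>psi q n x\<bar>" "\<bar>psi q n y\<bar>"] by (simp add: p_def abs_mult)
      then show "\<bar>p n\<bar> \<le> (psi q n x * psi q n x + psi q n y * psi q n y) / 2"
        by (simp add: power2_eq_square)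
    qed auto
    also have "\<dots> = B n"
      by (simp add: B_def t2 algebra_simps)
    finally show ?thesis by simp
  qed
  have "summable E"
    using EB by (intro summable_comparison_test'[OF sums_summable[OF B], of 0]) auto
  \<comment> \<open>Both parts converge, so the \<open>suminf\<close> in \<open>K\<close> is a
    genuine sum.\<close>
  then have "(\<lambda>n. E n + t n * p n) sums (suminf E + l * sqrt q * mehler_kernel q q x y)"
    by (intro sums_add summable_sums tp)
  then have "K q l x y = suminf E + l * sqrt q * mehler_kernel q q x y"
    unfolding K_def by (intro sums_unique[symmetric]) (simp add: E_def t_def p_def mult_ac)
  moreover have "norm (suminf E) \<le> suminf B"
    by (rule norm_suminf_le[OF EB sums_summable[OF B]])
  ultimately show ?thesis
    using sums_unique[OF B] by simp
qed

lemma beta_squared: "0 < q \<Longrightarrow> q < 1 \<Longrightarrow> (beta q)\<^sup>2 = (1 + q) / (1 - q)"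
  by (simp add: beta_def)

text \<open>At \<open>w = q\<close> the ratio \<open>(1 + w) / (1 - w)\<close> equals
  \<open>(beta q)\<^sup>2\<close>: it cancels in the first exponent and doubles the power of
  \<open>beta q\<close> in the second.\<close>

lemma mehler_kernel_base:
  assumes "0 < q" "q < 1"
  shows "mehler_kernel q q x y = 1 / ((1 - q) * sqrt pi)
    * exp (- ((x + y)\<^sup>2 / 4) - (beta q) ^ 4 * (x - y)\<^sup>2 / 4)"
proof -
  have f: "1 - q\<^sup>2 = (1 + q) * (1 - q)"
    by (simp add: power2_eq_square algebra_simps)
  have "sqrt ((1 + q) / (1 - q)) = (1 + q) / sqrt (1 - q\<^sup>2)"
  proof (rule real_sqrt_unique)
    show "((1 + q) / sqrt (1 - q\<^sup>2))\<^sup>2 = (1 + q) / (1 - q)"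
      unfolding f using assms by (simp add: power_divide power2_eq_square)
  qed (use assms in \<open>auto simp: abs_square_le_1\<close>)
  then have "beta q / sqrt (1 - q\<^sup>2) = (1 + q) / (1 - q\<^sup>2)"
    using assms by (simp add: beta_def abs_square_le_1)
  also have "\<dots> = 1 / (1 - q)"
    using assms abs_square_less_1[of q] by (simp add: field_simps power2_eq_square)
  finally have "beta q / sqrt (1 - q\<^sup>2) / sqrt pi = 1 / (1 - q) / sqrt pi"
    by simp
  then have pre: "beta q / sqrt (pi * (1 - q\<^sup>2)) = 1 / ((1 - q) * sqrt pi)"
    by (simp add: real_sqrt_mult mult.commute)
  have "(beta q) ^ 4 = ((beta q)\<^sup>2)\<^sup>2"
    by simp
  then have b4: "(beta q) ^ 4 = ((1 + q) / (1 - q))\<^sup>2"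
    unfolding beta_squared[OF assms] .
  have "(1 - q) / (1 + q) * ((1 + q) / (1 - q)) = 1"
    using assms by simp
  then have inv: "(1 - q) / (1 + q) * ((1 + q) / (1 - q) * A / 4) = A / 4" for A
    by (simp only: times_divide_eq_right[symmetric] mult.assoc[symmetric] mult_1)
  have sq: "r * (r * A / 4) = r\<^sup>2 * A / 4" for r A :: real
    by (simp add: power2_eq_square)
  show ?thesis
    unfolding mehler_kernel_def pre b4 beta_squared[OF assms] inv sq ..
qed

text \<open>The exact coefficient of \<open>- x\<^sup>2\<close> in the exponent is
  \<open>(1 + q)^2 / (1 + q^2)\<close>, which tends to 2 as \<open>q\<close> tends to 1. The value
  3/2 leaves room below 2 and still exceeds the coefficient 1 of the main term.\<close>

lemma mehler_kernel_diag_le: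
  assumes "1/2 \<le> q" "q < 1"
  shows "mehler_kernel q (q\<^sup>2) x x \<le> 1 / ((1 - q) * sqrt pi) * exp (- (3/2 * x\<^sup>2))"
proof -
  have q: "0 < q" "q < 1" using assms by auto
  have "beta q / sqrt (pi * (1 - (q\<^sup>2)\<^sup>2)) \<le> beta q / sqrt (pi * (1 - q\<^sup>2))"
    using q by (intro divide_left_mono)
      (auto simp: beta_def power_le_one power_less_one_iff mult_pos_pos)
  also have "\<dots> = 1 / ((1 - q) * sqrt pi)"
    \<comment> \<open>At the origin the exponentials are 1, which isolates the prefactor.\<close>
    using mehler_kernel_base[OF q, of 0 0] by (simp add: mehler_kernel_def)
  finally have pre: "beta q / sqrt (pi * (1 - (q\<^sup>2)\<^sup>2)) \<le> 1 / ((1 - q) * sqrt pi)" .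
  have "3/2 \<le> (1 - q\<^sup>2) / (1 + q\<^sup>2) * (beta q)\<^sup>2"
  proof -
    have "1 - q\<^sup>2 = (1 + q) * (1 - q)"
      by (simp add: power2_eq_square algebra_simps)
    then have eq: "(1 - q\<^sup>2) / (1 + q\<^sup>2) * (beta q)\<^sup>2 = (1 + q)\<^sup>2 / (1 + q\<^sup>2)"
      unfolding beta_squared[OF q] using q by (simp add: power2_eq_square[of "1 + q"])
    have "3/2 * (1 + q\<^sup>2) \<le> (1 + q)\<^sup>2"
    proof -
      have "q\<^sup>2 \<le> q"
        using q power_decreasing[of 1 2 q] by simp
      then show ?thesis
        unfolding power2_sum using assms by simp
    qed
    moreover have "1 + q\<^sup>2 > 0"
      by (simp add: add_pos_nonneg)
    ultimately show ?thesis
      unfolding eq by (simp add: le_divide_eq)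
  qed
  then have "3/2 * x\<^sup>2 \<le> (1 - q\<^sup>2) / (1 + q\<^sup>2) * (beta q)\<^sup>2 * x\<^sup>2"
    by (intro mult_right_mono) auto
  then have "exp (- ((1 - q\<^sup>2) / (1 + q\<^sup>2) * ((beta q)\<^sup>2 * (x + x)\<^sup>2 / 4))) \<le> exp (- (3/2 * x\<^sup>2))"
    by (simp add: power2_eq_square)
  with pre show ?thesis
    unfolding mehler_kernel_def using q by (intro mult_mono) auto
qed

section \<open>Asymptotics under the edge scaling\<close>

context
  fixes c :: real
  assumes c: "c > 0"
begin

lemma lam_pos: "lam c > 0"
  using c by (simp add: lam_def)

lemma q_param_bounds:
  assumes "N > 0"
  shows "0 < q_param c N" "q_param c N < 1"
  using c assms by (simp_all add: q_param_def mu_def)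

lemma q_param_tendsto: "q_param c \<longlonglongrightarrow> 1"
  unfolding q_param_def mu_def using c by real_asymp

text \<open>By \<open>mehler_kernel_base\<close>, this is the scaled main term on the
  diagonal.\<close>

definition edge_density :: "nat \<Rightarrow> real \<Rightarrow> real" where
  "edge_density N \<xi> = b_scale N * (lam c * sqrt (q_param c N) / ((1 - q_param c N) * sqrt pi))
     * exp (- (a_scale c N + b_scale N * \<xi>)\<^sup>2)"

text \<open>This explains \<open>a_scale\<close>. With \<open>s = sqrt L\<close> the point is
  \<open>s + r\<close> where \<open>2 * s * r = \<xi> - l / 2\<close>, so its Gaussian is
  \<open>exp (- L) * exp (- \<xi>) * exp (l / 2) * exp (- r\<^sup>2)\<close>. Here
  \<open>exp (- L) = 1 / N\<close>, and \<open>l\<close> is chosen such that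
  \<open>exp (l / 2)\<close> cancels \<open>b_scale N\<close>, \<open>lam c\<close> and
  \<open>sqrt pi\<close>.\<close>

lemma edge_density_eq:
  assumes N: "N \<ge> 2"
  defines "L \<equiv> ln (real N)"
  shows "edge_density N \<xi> = exp (- \<xi>) * (sqrt (q_param c N) / ((1 - q_param c N) * (c * real N)))
    * exp (- ((\<xi> - ln (4 * pi * L / ((lam c)\<^sup>2 * c\<^sup>2)) / 2) / (2 * sqrt L))\<^sup>2)"
proof -
  define l where "l = ln (4 * pi * L / ((lam c)\<^sup>2 * c\<^sup>2))"
  define r where "r = (\<xi> - l / 2) / (2 * sqrt L)"
  define s where "s = sqrt L"
  have L: "L > 0" using N by (simp add: L_def)
  then have s: "s > 0" "s\<^sup>2 = L" by (simp_all add: s_def)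
  have "a_scale c N + b_scale N * \<xi> = s + r"
    unfolding a_scale_def b_scale_def r_def l_def s_def L_def[symmetric]
    using L by (simp add: field_simps)
  moreover have "2 * s * r = \<xi> - l / 2"
    using s by (simp add: r_def s_def[symmetric])
  ultimately have sq: "(a_scale c N + b_scale N * \<xi>)\<^sup>2 = L + (\<xi> - l / 2) + r\<^sup>2"
    by (simp add: power2_sum s(2))
  have "l / 2 = ln (sqrt (4 * pi * L / ((lam c)\<^sup>2 * c\<^sup>2)))"
    unfolding l_def using L c lam_pos by (simp add: ln_sqrt)
  then have "exp (l / 2) = sqrt (4 * pi * L / ((lam c)\<^sup>2 * c\<^sup>2))"
    using L c lam_pos by simp
  also have "\<dots> = 2 * sqrt pi * s / (lam c * c)"
    using c lam_pos by (simp add: s_def real_sqrt_mult real_sqrt_divide)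
  finally have l2: "exp (l / 2) = 2 * sqrt pi * s / (lam c * c)" .
  have eL: "exp (- L) = 1 / real N"
    using N by (simp add: L_def exp_minus field_simps)
  have "exp (- (a_scale c N + b_scale N * \<xi>)\<^sup>2) = exp (- L) * exp (- \<xi>) * exp (l / 2) * exp (- r\<^sup>2)"
    unfolding sq by (simp add: exp_add[symmetric])
  also have "\<dots> = exp (- \<xi>) * (2 * sqrt pi * s / (lam c * c * real N)) * exp (- r\<^sup>2)"
    unfolding eL l2 by simp
  finally have ex: "exp (- (a_scale c N + b_scale N * \<xi>)\<^sup>2)
    = exp (- \<xi>) * (2 * sqrt pi * s / (lam c * c * real N)) * exp (- r\<^sup>2)" .
  have b: "b_scale N = 1 / (2 * s)"
    by (simp add: b_scale_def s_def L_def)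
  have "edge_density N \<xi> = exp (- \<xi>) * (sqrt (q_param c N) / ((1 - q_param c N) * (c * real N))) * exp (- r\<^sup>2)"
    unfolding edge_density_def ex unfolding b using s(1) c lam_pos q_param_bounds[of N] N
    by (simp add: field_simps)
  then show ?thesis
    unfolding r_def l_def .
qed

text \<open>The two correction factors tend to 1: \<open>1 - q\<close> is asymptotic to
  \<open>1 / (c * N)\<close>, and the squared quantity is of order
  \<open>ln (ln N) / sqrt (ln N)\<close> before squaring.\<close>

lemma edge_density_tendsto: "(\<lambda>N. edge_density N \<xi>) \<longlonglongrightarrow> exp (- \<xi>)"
proof -
  have 1: "(\<lambda>N. sqrt (q_param c N) / ((1 - q_param c N) * (c * real N))) \<longlonglongrightarrow> 1"
    unfolding q_param_def mu_def using c by real_asymp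
  define k where "k = 4 * pi / ((lam c)\<^sup>2 * c\<^sup>2)"
  have "k > 0"
    using c lam_pos by (simp add: k_def)
  then have "(\<lambda>N. (\<xi> - ln (k * ln (real N)) / 2) / (2 * sqrt (ln (real N)))) \<longlonglongrightarrow> 0"
    by real_asymp
  from tendsto_exp[OF tendsto_minus[OF tendsto_power[OF this, of 2]]]
  have 2: "(\<lambda>N. exp (- ((\<xi> - ln (k * ln (real N)) / 2) / (2 * sqrt (ln (real N))))\<^sup>2)) \<longlonglongrightarrow> 1"
    by simp
  have "(\<lambda>N. exp (- \<xi>) * (sqrt (q_param c N) / ((1 - q_param c N) * (c * real N)))
     * exp (- ((\<xi> - ln (k * ln (real N)) / 2) / (2 * sqrt (ln (real N))))\<^sup>2)) \<longlonglongrightarrow> exp (- \<xi>) * 1 * 1"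
    by (intro tendsto_mult tendsto_const 1 2)
  moreover have "\<forall>\<^sub>F N in sequentially. exp (- \<xi>) * (sqrt (q_param c N) / ((1 - q_param c N) * (c * real N)))
     * exp (- ((\<xi> - ln (k * ln (real N)) / 2) / (2 * sqrt (ln (real N))))\<^sup>2) = edge_density N \<xi>"
    using eventually_ge_at_top[of 2] by eventually_elim (simp add: edge_density_eq k_def)
  ultimately show ?thesis
    by (simp add: tendsto_cong)
qed

lemma scaled_point_at_top: "filterlim (\<lambda>N. a_scale c N + b_scale N * \<xi>) at_top sequentially"
proof -
  define k where "k = 4 * pi / ((lam c)\<^sup>2 * c\<^sup>2)"
  have "k > 0"
    using c lam_pos by (simp add: k_def)
  then have "filterlim (\<lambda>N. sqrt (ln (real N)) - ln (k * ln (real N)) / (4 * sqrt (ln (real N)))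
      + 1 / (2 * sqrt (ln (real N))) * \<xi>) at_top sequentially"
    by real_asymp
  then show ?thesis
    by (simp add: a_scale_def b_scale_def k_def)
qed

text \<open>The sum of the points yields the edge density at the midpoint of \<open>\<xi>\<close>
  and \<open>\<eta>\<close>. Their difference yields the factor \<open>d\<close>, whose exponent off
  the diagonal is of order \<open>N^2 / ln N\<close>.\<close>

lemma main_term_tendsto:
  "(\<lambda>N. b_scale N * (lam c * sqrt (q_param c N) * mehler_kernel (q_param c N) (q_param c N)
      (a_scale c N + b_scale N * \<xi>) (a_scale c N + b_scale N * \<eta>))) \<longlonglongrightarrow> K_ext \<xi> \<eta>"
proof -
  define d where "d N = exp (- ((beta (q_param c N)) ^ 4 * (b_scale N * (\<xi> - \<eta>))\<^sup>2 / 4))" for N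
  have d: "d \<longlonglongrightarrow> (if \<xi> = \<eta> then 1 else 0)"
  proof (cases "\<xi> = \<eta>")
    case False
    define e where "e = (\<xi> - \<eta>)\<^sup>2"
    have "e > 0" using False by (simp add: e_def)
    then have "(\<lambda>N. exp (- (((1 + exp (- (1 / (c * real N)))) / (1 - exp (- (1 / (c * real N)))))\<^sup>2
       * ((1 / (2 * sqrt (ln (real N))))\<^sup>2 * e) / 4))) \<longlonglongrightarrow> 0"
      using c by real_asymp
    moreover have "\<forall>\<^sub>F N in sequentially. exp (- (((1 + exp (- (1 / (c * real N)))) / (1 - exp (- (1 / (c * real N)))))\<^sup>2
       * ((1 / (2 * sqrt (ln (real N))))\<^sup>2 * e) / 4)) = d N"
      using eventually_gt_at_top[of 0]
    proof eventually_elim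
      case (elim N)
      have "(beta (q_param c N)) ^ 4 = ((beta (q_param c N))\<^sup>2)\<^sup>2"
        by simp
      then have "(beta (q_param c N)) ^ 4
          = ((1 + exp (- (1 / (c * real N)))) / (1 - exp (- (1 / (c * real N)))))\<^sup>2"
        unfolding beta_squared[OF q_param_bounds[OF elim]] by (simp add: q_param_def mu_def)
      then show ?case
        by (simp add: d_def e_def b_scale_def power_mult_distrib power_divide)
    qed
    ultimately show ?thesis
      using False by (simp add: tendsto_cong)
  qed (simp add: d_def[abs_def])
  have "(\<lambda>N. edge_density N ((\<xi> + \<eta>) / 2) * d N) \<longlonglongrightarrow> exp (- ((\<xi> + \<eta>) / 2)) * (if \<xi> = \<eta> then 1 else 0)"
    by (intro tendsto_mult edge_density_tendsto d)
  moreover have "exp (- ((\<xi> + \<eta>) / 2)) * (if \<xi> = \<eta> then 1 else 0) = K_ext \<xi> \<eta>"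
    by (simp add: K_ext_def)
  ultimately have "(\<lambda>N. edge_density N ((\<xi> + \<eta>) / 2) * d N) \<longlonglongrightarrow> K_ext \<xi> \<eta>"
    by (simp only:)
  then show ?thesis
  proof (rule Lim_transform_eventually)
    show "\<forall>\<^sub>F N in sequentially. edge_density N ((\<xi> + \<eta>) / 2) * d N =
      b_scale N * (lam c * sqrt (q_param c N) * mehler_kernel (q_param c N) (q_param c N)
      (a_scale c N + b_scale N * \<xi>) (a_scale c N + b_scale N * \<eta>))"
      using eventually_gt_at_top[of 0]
    proof eventually_elim
      case (elim N)
      let ?x = "a_scale c N + b_scale N * \<xi>" and ?y = "a_scale c N + b_scale N * \<eta>"
      have sum: "(?x + ?y)\<^sup>2 / 4 = (a_scale c N + b_scale N * ((\<xi> + \<eta>) / 2))\<^sup>2"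
        by (simp add: power2_eq_square field_simps)
      have diff: "?x - ?y = b_scale N * (\<xi> - \<eta>)"
        by (simp add: algebra_simps)
      have "exp (- A - B) = exp (- A) * exp (- B)" for A B :: real
        by (simp flip: exp_add)
      then show ?case
        unfolding mehler_kernel_base[OF q_param_bounds[OF elim]] edge_density_def d_def sum diff
        by simp
    qed
  qed
qed

text \<open>Of the bound \<open>exp (- (3/2 * x\<^sup>2))\<close>, one factor
  \<open>exp (- x\<^sup>2)\<close> goes into the convergent edge density; the remaining
  \<open>exp (- (x\<^sup>2 / 2))\<close> vanishes because the points tend to infinity.\<close>

lemma remainder_tendsto:
  "(\<lambda>N. b_scale N * ((lam c)\<^sup>2 * q_param c N * mehler_kernel (q_param c N) ((q_param c N)\<^sup>2)
      (a_scale c N + b_scale N * \<xi>) (a_scale c N + b_scale N * \<xi>))) \<longlonglongrightarrow> 0"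
proof -
  define x where "x N = a_scale c N + b_scale N * \<xi>" for N
  have "filterlim x at_top sequentially"
    unfolding x_def by (rule scaled_point_at_top)
  moreover have "((\<lambda>x::real. exp (- (x\<^sup>2 / 2))) \<longlongrightarrow> 0) at_top"
    by real_asymp
  ultimately have "(\<lambda>N. exp (- ((x N)\<^sup>2 / 2))) \<longlonglongrightarrow> 0"
    by (rule filterlim_compose[rotated])
  then have "(\<lambda>N. lam c * sqrt (q_param c N) * edge_density N \<xi> * exp (- ((x N)\<^sup>2 / 2)))
      \<longlonglongrightarrow> lam c * sqrt 1 * exp (- \<xi>) * 0"
    by (intro tendsto_mult tendsto_const tendsto_real_sqrt q_param_tendsto edge_density_tendsto)
  then have lim: "(\<lambda>N. lam c * sqrt (q_param c N) * edge_density N \<xi> * exp (- ((x N)\<^sup>2 / 2))) \<longlonglongrightarrow> 0"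
    by simp
  have "\<forall>\<^sub>F N in sequentially. q_param c N > 1/2"
    using order_tendstoD(1)[OF q_param_tendsto, of "1/2"] by simp
  then have upper: "\<forall>\<^sub>F N in sequentially. b_scale N * ((lam c)\<^sup>2 * q_param c N
      * mehler_kernel (q_param c N) ((q_param c N)\<^sup>2)
      (a_scale c N + b_scale N * \<xi>) (a_scale c N + b_scale N * \<xi>))
      \<le> lam c * sqrt (q_param c N) * edge_density N \<xi> * exp (- ((x N)\<^sup>2 / 2))"
    using eventually_gt_at_top[of 0]
  proof eventually_elim
    case (elim N)
    define q where "q = q_param c N"
    have q: "1/2 \<le> q" "0 < q" "q < 1"
      using elim q_param_bounds[of N] by (auto simp: q_def)
    have "mehler_kernel q (q\<^sup>2) (x N) (x N) \<le> 1 / ((1 - q) * sqrt pi) * exp (- (3/2 * (x N)\<^sup>2))"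
      by (rule mehler_kernel_diag_le[OF q(1,3)])
    also have "exp (- (3/2 * (x N)\<^sup>2)) = exp (- (x N)\<^sup>2) * exp (- ((x N)\<^sup>2 / 2))"
      by (simp add: exp_add[symmetric])
    finally have "b_scale N * ((lam c)\<^sup>2 * q * mehler_kernel q (q\<^sup>2) (x N) (x N))
      \<le> b_scale N * ((lam c)\<^sup>2 * q * (1 / ((1 - q) * sqrt pi) * (exp (- (x N)\<^sup>2) * exp (- ((x N)\<^sup>2 / 2)))))"
      using q elim by (intro mult_left_mono) (auto simp: b_scale_def)
    also have "\<dots> = lam c * sqrt q * (b_scale N * (lam c * sqrt q / ((1 - q) * sqrt pi)) * exp (- (x N)\<^sup>2))
        * exp (- ((x N)\<^sup>2 / 2))"
    proof -
      \<comment> \<open>One factor \<open>sqrt q\<close> is absorbed by \<open>edge_density\<close>,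
        the other stays in front.\<close>
      have "q = sqrt q * sqrt q" using q by simp
      then have "b * (l\<^sup>2 * q * (1 / z * (e * e'))) = l * sqrt q * (b * (l * sqrt q / z) * e) * e'"
        for b l z e e' :: real
        by (metis (no_types, opaque_lifting) mult.assoc mult.commute mult.left_commute
            mult_1 power2_eq_square times_divide_eq_left times_divide_eq_right)
      then show ?thesis .
    qed
    finally show ?case
      by (simp add: edge_density_def x_def q_def)
  qed
  have nonneg: "\<forall>\<^sub>F N in sequentially. 0 \<le> b_scale N * ((lam c)\<^sup>2 * q_param c N
      * mehler_kernel (q_param c N) ((q_param c N)\<^sup>2)
      (a_scale c N + b_scale N * \<xi>) (a_scale c N + b_scale N * \<xi>))"
    using eventually_gt_at_top[of 0]
  proof eventually_elim
    case (elim N)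
    then show ?case
      using q_param_bounds[OF elim]
      by (simp add: b_scale_def mehler_kernel_def beta_def power_le_one)
  qed
  show ?thesis
    by (rule tendsto_sandwich[OF nonneg upper tendsto_const lim])
qed

end

section \<open>Main term and error combined\<close>

theorem theorem1p10:
  fixes c \<xi> \<eta> :: real
  assumes "c > 0"
  shows "(\<lambda>N. b_scale N * K (q_param c N) (lam c)
             (a_scale c N + b_scale N * \<xi>) (a_scale c N + b_scale N * \<eta>))
         \<longlonglongrightarrow> K_ext \<xi> \<eta>"
proof -
  define x where "x \<xi> N = a_scale c N + b_scale N * \<xi>" for \<xi> N
  define f where "f N = b_scale N * K (q_param c N) (lam c) (x \<xi> N) (x \<eta> N)" for N
  define g where "g N = b_scale N * (lam c * sqrt (q_param c N)
      * mehler_kernel (q_param c N) (q_param c N) (x \<xi> N) (x \<eta> N))" for N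
  \<comment> \<open>The scaled error bound is the mean of these remainders at the two
    points.\<close>
  define e where "e \<xi> N = b_scale N * ((lam c)\<^sup>2 * q_param c N
      * mehler_kernel (q_param c N) ((q_param c N)\<^sup>2) (x \<xi> N) (x \<xi> N))" for \<xi> N
  have "(\<lambda>N. (e \<xi> N + e \<eta> N) / 2) \<longlonglongrightarrow> (0 + 0) / 2"
    unfolding e_def x_def by (intro tendsto_intros remainder_tendsto[OF assms]) simp
  then have "(\<lambda>N. (e \<xi> N + e \<eta> N) / 2) \<longlonglongrightarrow> 0"
    by simp
  moreover have "\<forall>\<^sub>F N in sequentially. norm (f N - g N) \<le> (e \<xi> N + e \<eta> N) / 2"
    using eventually_gt_at_top[of 0]
  proof eventually_elim
    case (elim N)
    have b: "b_scale N \<ge> 0"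
      using elim by (simp add: b_scale_def)
    have "norm (f N - g N) = b_scale N * \<bar>K (q_param c N) (lam c) (x \<xi> N) (x \<eta> N)
        - lam c * sqrt (q_param c N) * mehler_kernel (q_param c N) (q_param c N) (x \<xi> N) (x \<eta> N)\<bar>"
      unfolding f_def g_def right_diff_distrib[symmetric] using b by (simp add: abs_mult)
    also have "\<dots> \<le> b_scale N * ((lam c)\<^sup>2 * q_param c N *
        ((mehler_kernel (q_param c N) ((q_param c N)\<^sup>2) (x \<xi> N) (x \<xi> N)
        + mehler_kernel (q_param c N) ((q_param c N)\<^sup>2) (x \<eta> N) (x \<eta> N)) / 2))"
      by (intro mult_left_mono b K_mehler_kernel_bound q_param_bounds lam_pos assms elim)
    also have "\<dots> = (e \<xi> N + e \<eta> N) / 2"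
      by (simp add: e_def algebra_simps)
    finally show ?case .
  qed
  ultimately have "(\<lambda>N. f N - g N) \<longlonglongrightarrow> 0"
    by (rule Lim_null_comparison[rotated])
  moreover have "g \<longlonglongrightarrow> K_ext \<xi> \<eta>"
    unfolding g_def x_def by (rule main_term_tendsto[OF assms])
  ultimately have "(\<lambda>N. f N - g N + g N) \<longlonglongrightarrow> 0 + K_ext \<xi> \<eta>"
    by (rule tendsto_add)
  then show ?thesis
    by (simp add: f_def x_def)
qed

end
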